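(* Let $F=\Bbbk\langle x,y\rangle$ and let $D$ be the $\Bbbk$-derivation of $F$ defined by $D(y)=0$ and $D(x)=[x,y]=xy-yx$. Then $D$ is not locally nilpotent, while $\mathrm{Aut}_D(F)$ contains automorphisms of arbitrarily large degree, i.e. for every integer $d\ge1$ there is $\rho\in\mathrm{Aut}_D(F)$ with $\deg(\rho)\ge d$.
   Context: $\Bbbk$ is an algebraically closed field of characteristic zero and $F=\Bbbk\langle x,y\rangle$ is the free associative unital $\Bbbk$-algebra on two generators. For a $\Bbbk$-algebra automorphism $\rho$ of $F$, $\deg(\rho)=\max\{\deg(\rho(x)),\deg(\rho(y))\}$, where $\deg$ is the usual total degree of noncommutative polynomials in $x,y$. For a $\Bbbk$-derivation $D$ of $F$, $\mathrm{Aut}_D(F)=\{\rho\in\mathrm{Aut}(F)\mid\rho D=D\rho\}$, where $\mathrm{Aut}(F)$ is the group of $\Bbbk$-algebra automorphisms; $D$ is locally nilpotent if for every $a\in F$ there is $n\ge1$ with $D^n(a)=0$. *)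

theory Defs
  imports "HOL-Library.Poly_Mapping" "HOL-Computational_Algebra.Polynomial"
begin

text \<open>
  \<open>'g fmonoid\<close> is the free monoid on \<open>'g\<close>. It is written additively because the product of
  \<^theory>\<open>HOL-Library.Poly_Mapping\<close> is the convolution product over a (not necessarily commutative)
  additive monoid of exponents; in particular \<open>+\<close> on words is concatenation.
\<close>

datatype 'g fmonoid = Word (letters: "'g list")

instantiation fmonoid :: (type) monoid_add
begin

definition zero_fmonoid :: "'a fmonoid" where
  "0 = Word []"

definition plus_fmonoid :: "'a fmonoid \<Rightarrow> 'a fmonoid \<Rightarrow> 'a fmonoid" where
  "u + v = Word (letters u @ letters v)"

instance
  by standard (simp_all add: zero_fmonoid_def plus_fmonoid_def)

end

datatype gen = GX | GY

type_synonym 'k free_alg = "gen fmonoid \<Rightarrow>\<^sub>0 'k"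

definition X :: "'k::field free_alg" where
  "X = Poly_Mapping.single (Word [GX]) 1"

definition Y :: "'k::field free_alg" where
  "Y = Poly_Mapping.single (Word [GY]) 1"

definition scale :: "'k::field \<Rightarrow> 'k free_alg \<Rightarrow> 'k free_alg" where
  "scale c = Poly_Mapping.map ((*) c)"

text \<open>Total degree; the zero polynomial is given degree \<open>0\<close>.\<close>

definition deg :: "'k::field free_alg \<Rightarrow> nat" where
  "deg p = Max (insert 0 ((\<lambda>w. length (letters w)) ` Poly_Mapping.keys p))"

definition alg_automorphism :: "('k::field free_alg \<Rightarrow> 'k free_alg) \<Rightarrow> bool" where
  "alg_automorphism \<rho> \<longleftrightarrow>
     bij \<rho> \<and> Vector_Spaces.linear scale scale \<rho> \<and> \<rho> 1 = 1 \<and> (\<forall>p q. \<rho> (p * q) = \<rho> p * \<rho> q)"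

definition aut_deg :: "('k::field free_alg \<Rightarrow> 'k free_alg) \<Rightarrow> nat" where
  "aut_deg \<rho> = max (deg (\<rho> X)) (deg (\<rho> Y))"

definition derivation :: "('k::field free_alg \<Rightarrow> 'k free_alg) \<Rightarrow> bool" where
  "derivation D \<longleftrightarrow>
     Vector_Spaces.linear scale scale D \<and> (\<forall>p q. D (p * q) = D p * q + p * D q)"

definition locally_nilpotent :: "('k::field free_alg \<Rightarrow> 'k free_alg) \<Rightarrow> bool" where
  "locally_nilpotent D \<longleftrightarrow> (\<forall>a. \<exists>n\<ge>1. (D ^^ n) a = 0)"

definition Aut_comm :: "('k::field free_alg \<Rightarrow> 'k free_alg) \<Rightarrow> ('k free_alg \<Rightarrow> 'k free_alg) set" where
  "Aut_comm D = {\<rho>. alg_automorphism \<rho> \<and> \<rho> \<circ> D = D \<circ> \<rho>}"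

lemma scale_conv_mult: "scale c p = Poly_Mapping.single 0 c * p"
  by (simp add: scale_def mult_map_scale_conv_mult)

lemma vector_space_scale: "vector_space (scale :: 'k::field \<Rightarrow> _)"
  by unfold_locales
    (simp_all add: scale_conv_mult algebra_simps single_add mult_single flip: mult.assoc)

lemma lookup_scale: "Poly_Mapping.lookup (scale c p) w = c * Poly_Mapping.lookup p w"
  by (simp add: scale_def Poly_Mapping.map.rep_eq when_def)

lemma scale_mult_right: "p * scale c q = scale c (p * (q :: 'k::field free_alg))"
proof -
  have "p * Poly_Mapping.single 0 c = Poly_Mapping.single 0 c * p"
  proof (induction p rule: Poly_Mapping.update_induct)
    case const
    show ?case by simp
  next
    case (update f a b)
    have "Poly_Mapping.update a b f = f + Poly_Mapping.single a b"
      using update.hyps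
      by (intro poly_mapping_eqI)
        (auto simp: lookup_update lookup_add lookup_single when_def in_keys_iff)
    then show ?case
      using update by (simp add: algebra_simps mult_single)
  qed
  then show ?thesis
    by (simp add: scale_conv_mult flip: mult.assoc)
qed

lemma derivation_commutator_Y: "derivation (\<lambda>p. p * Y - Y * (p :: 'k::field free_alg))"
proof -
  have left: "scale c p * q = scale c (p * q)" for c and p q :: "'k free_alg"
    by (simp add: scale_conv_mult mult.assoc)
  interpret vector_space_pair "scale :: 'k \<Rightarrow> _" "scale :: 'k \<Rightarrow> _"
    by (simp add: vector_space_pair_def vector_space_scale)
  have "Vector_Spaces.linear scale scale (\<lambda>p. p * Y - Y * (p :: 'k free_alg))"
    by (unfold linear_iff_module_hom module_hom_iff)
      (simp_all add: vs1.module_axioms left scale_mult_right algebra_simps vs1.scale_right_diff_distrib)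
  then show ?thesis
    by (simp add: derivation_def algebra_simps)
qed

lemma derivation_eqI:
  fixes D E :: "'k::field free_alg \<Rightarrow> 'k free_alg"
  assumes "derivation D" "derivation E" "D X = E X" "D Y = E Y"
  shows "D = E"
proof
  fix p :: "'k free_alg"
  interpret D: Vector_Spaces.linear scale scale D using assms(1) by (simp add: derivation_def)
  interpret E: Vector_Spaces.linear scale scale E using assms(2) by (simp add: derivation_def)
  have leib: "D (p * q) = D p * q + p * D q" "E (p * q) = E p * q + p * E q" for p q
    using assms(1,2) by (simp_all add: derivation_def)
  have one: "D 1 = 0" "E 1 = 0"
    using leib[of 1 1] by simp_all
  have word: "D (Poly_Mapping.single (Word us) 1) = E (Poly_Mapping.single (Word us) 1)" for us
  proof (induction us)
    case Nil
    have "Poly_Mapping.single (Word []) 1 = (1 :: 'k free_alg)"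
      by (simp flip: zero_fmonoid_def)
    then show ?case by (simp add: one)
  next
    case (Cons g us)
    have "Poly_Mapping.single (Word (g # us)) 1 =
        (if g = GX then X else Y) * (Poly_Mapping.single (Word us) 1 :: 'k free_alg)"
      by (cases g) (simp_all add: X_def Y_def mult_single plus_fmonoid_def)
    then show ?case
      using Cons.IH assms(3,4) by (simp add: leib)
  qed
  show "D p = E p"
  proof (induction p rule: Poly_Mapping.update_induct)
    case const
    show ?case by (simp add: D.zero E.zero)
  next
    case (update f a b)
    have "Poly_Mapping.update a b f = f + scale b (Poly_Mapping.single (Word (letters a)) 1)"
      using update.hyps
      by (intro poly_mapping_eqI)
        (auto simp: lookup_update lookup_add lookup_scale lookup_single when_def in_keys_iff)
    then show ?case
      using update.IH word by (simp only: D.add E.add D.scale E.scale)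
  qed
qed

text \<open>
  Hence \<open>derivation D\<close>, \<open>D X = X * Y - Y * X\<close> and \<open>D Y = 0\<close> may serve as hypotheses on a
  variable \<open>D\<close>: exactly one \<open>D\<close> satisfies them.
\<close>

lemma ex1_derivation:
  "\<exists>!D :: 'k::field free_alg \<Rightarrow> _. derivation D \<and> D X = X * Y - Y * X \<and> D Y = 0"
proof (rule ex1I[of _ "\<lambda>p. p * Y - Y * p"])
  show "derivation (\<lambda>p. p * Y - Y * (p :: 'k free_alg)) \<and>
      X * Y - Y * X = X * Y - Y * X \<and> Y * Y - Y * Y = (0 :: 'k free_alg)"
    by (simp add: derivation_commutator_Y)
next
  fix D :: "'k free_alg \<Rightarrow> 'k free_alg"
  assume D: "derivation D \<and> D X = X * Y - Y * X \<and> D Y = 0"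
  show "D = (\<lambda>p. p * Y - Y * p)"
    by (rule derivation_eqI) (use D in \<open>simp_all add: derivation_commutator_Y\<close>)
qed

end

theory Submission
  imports Defs
begin

text \<open>
  Two derivations that agree on \<open>X\<close> and \<open>Y\<close> are equal (\<open>derivation_eqI\<close>), so \<open>D\<close> is the inner
  derivation \<open>p \<mapsto> p Y - Y p\<close>. Both claims can be read off from this form.

  \<^item> In \<open>D\<^sup>n X\<close> the word \<open>X Y\<^sup>n\<close> has coefficient \<open>1\<close>: each application of \<open>D\<close> appends a letter \<open>Y\<close>
    through the summand \<open>p Y\<close>, and the summand \<open>Y p\<close> contains only words that begin with \<open>Y\<close>. So no
    power of \<open>D\<close> kills \<open>X\<close> (\<open>lookup_iterated_commutator\<close>).

  \<^item> An algebra endomorphism that fixes \<open>Y\<close> commutes with commutation by \<open>Y\<close>. The elementary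
    automorphism \<open>X \<mapsto> X + Y\<^sup>d\<close>, \<open>Y \<mapsto> Y\<close>, with inverse \<open>X \<mapsto> X - Y\<^sup>d\<close>, \<open>Y \<mapsto> Y\<close>, therefore lies
    in the centralizer of \<open>D\<close>, and its degree is at least \<open>d\<close> (\<open>alg_automorphism_elementary\<close>,
    \<open>aut_deg_elementary\<close>).

  The bulk of the work is the universal property of the free algebra, which supplies these
  endomorphisms: every choice of images of \<open>X\<close> and \<open>Y\<close> extends to an algebra endomorphism
  (\<open>alg_endomorphism_subst\<close>), and the extension is unique (\<open>alg_endomorphism_eqI\<close>).
\<close>

section \<open>Induction on the free algebra\<close>

lemma single_word_induct [case_names zero add single]:
  fixes p :: "'k::field free_alg"
  assumes "P 0"
    and "\<And>p q. P p \<Longrightarrow> P q \<Longrightarrow> P (p + q)"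
    and "\<And>us c. P (Poly_Mapping.single (Word us) c)"
  shows "P p"
proof (induction p rule: Poly_Mapping.update_induct)
  case const
  show ?case by (fact assms(1))
next
  case (update f w c)
  have "Poly_Mapping.update w c f = f + Poly_Mapping.single (Word (letters w)) c"
    using update.hyps
    by (intro poly_mapping_eqI)
      (auto simp: lookup_update lookup_add lookup_single when_def in_keys_iff)
  then show ?case
    using assms(2)[OF update.IH assms(3)[of "letters w" c]] by simp
qed

text \<open>
  The left factor is a conditional rather than two separate equations so that induction over words
  can treat both letters at once.
\<close>

lemma single_Word_Cons:
  "Poly_Mapping.single (Word (g # us)) c =
    (if g = GX then X else Y) * (Poly_Mapping.single (Word us) c :: 'k::field free_alg)"
  by (cases g) (simp_all add: X_def Y_def mult_single plus_fmonoid_def)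

lemma single_Word_Nil: "Poly_Mapping.single (Word []) c = scale c (1 :: 'k::field free_alg)"
  by (simp add: scale_conv_mult flip: zero_fmonoid_def)

text \<open>
  As an algebra, the free algebra is generated by \<open>X\<close> and \<open>Y\<close>. This form suits statements that
  are compatible with all algebra operations; \<open>single_word_induct\<close> suits statements that are
  merely linear.
\<close>

lemma free_alg_induct [case_names one X Y add mult scale]:
  fixes p :: "'k::field free_alg"
  assumes "P 1" "P X" "P Y"
    and "\<And>p q. P p \<Longrightarrow> P q \<Longrightarrow> P (p + q)"
    and "\<And>p q. P p \<Longrightarrow> P q \<Longrightarrow> P (p * q)"
    and "\<And>c p. P p \<Longrightarrow> P (scale c p)"
  shows "P p"
proof (induction p rule: single_word_induct)
  case zero
  have "P (scale 0 1)" by (intro assms)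
  then show ?case by (simp add: scale_conv_mult)
next
  case (add p q)
  then show ?case by (rule assms(4))
next
  case (single us c)
  show ?case
    by (induction us) (simp_all add: single_Word_Nil single_Word_Cons assms)
qed

section \<open>Endomorphisms and the universal property\<close>

definition alg_endomorphism :: "('k::field free_alg \<Rightarrow> 'k free_alg) \<Rightarrow> bool" where
  "alg_endomorphism f \<longleftrightarrow>
     Vector_Spaces.linear scale scale f \<and> f 1 = 1 \<and> (\<forall>p q. f (p * q) = f p * f q)"

lemma linear_scale_iff:
  "Vector_Spaces.linear scale scale f \<longleftrightarrow>
    (\<forall>p q. f (p + q) = f p + f q) \<and> (\<forall>c p. f (scale c p) = scale c (f p))"
  for f :: "'k::field free_alg \<Rightarrow> 'k free_alg"
proof -
  interpret vector_space "scale :: 'k \<Rightarrow> _" by (rule vector_space_scale)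
  show ?thesis
    by (simp add: linear_iff_module_hom module_hom_iff module_axioms)
qed

lemma alg_endomorphism_iff:
  "alg_endomorphism f \<longleftrightarrow>
    (\<forall>p q. f (p + q) = f p + f q) \<and> (\<forall>c p. f (scale c p) = scale c (f p)) \<and>
    f 1 = 1 \<and> (\<forall>p q. f (p * q) = f p * f q)"
  for f :: "'k::field free_alg \<Rightarrow> 'k free_alg"
  by (auto simp: alg_endomorphism_def linear_scale_iff)

lemma alg_endomorphism_eqI:
  fixes f g :: "'k::field free_alg \<Rightarrow> 'k free_alg"
  assumes "alg_endomorphism f" "alg_endomorphism g" "f X = g X" "f Y = g Y"
  shows "f = g"
proof
  fix p :: "'k free_alg"
  show "f p = g p"
    by (induction p rule: free_alg_induct)
      (use assms in \<open>simp_all add: alg_endomorphism_iff\<close>)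
qed

definition subst :: "'k::field free_alg \<Rightarrow> 'k free_alg \<Rightarrow> 'k free_alg \<Rightarrow> 'k free_alg" where
  "subst a b p = (\<Sum>w\<in>Poly_Mapping.keys p. scale (Poly_Mapping.lookup p w)
     (prod_list (map (case_gen a b) (letters w))))"

lemma scale_zero [simp]: "scale 0 p = (0 :: 'k::field free_alg)"
  by (simp add: scale_conv_mult)

lemma scale_add_left: "scale (c + d) p = scale c p + scale d (p :: 'k::field free_alg)"
  by (simp add: scale_conv_mult single_add algebra_simps)

lemma scale_add_right: "scale c (p + q) = scale c p + scale c (q :: 'k::field free_alg)"
  by (simp add: scale_conv_mult algebra_simps)

lemma scale_scale: "scale c (scale d p) = scale (c * d) (p :: 'k::field free_alg)"
  by (simp add: scale_conv_mult mult_single flip: mult.assoc)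

lemma scale_mult_left: "scale c p * q = scale c (p * (q :: 'k::field free_alg))"
  by (simp add: scale_conv_mult mult.assoc)

text \<open>
  Summing over a larger finite set of words makes the sums for different polynomials comparable,
  since the set of words that occur in \<open>p + q\<close> need not contain those that occur in \<open>p\<close>.
\<close>

lemma subst_eq_sum:
  assumes "finite A" "Poly_Mapping.keys p \<subseteq> A"
  shows "subst a b p = (\<Sum>w\<in>A. scale (Poly_Mapping.lookup p w)
     (prod_list (map (case_gen a b) (letters w))))"
  unfolding subst_def using assms
  by (intro sum.mono_neutral_left) (auto simp: in_keys_iff)

lemma subst_add: "subst a b (p + q) = subst a b p + subst a b q"
proof -
  let ?A = "Poly_Mapping.keys p \<union> Poly_Mapping.keys q"
  have "finite ?A" "Poly_Mapping.keys (p + q) \<subseteq> ?A"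
    by (simp_all add: Poly_Mapping.keys_add)
  then show ?thesis
    by (simp add: subst_eq_sum[of ?A] lookup_add scale_add_left sum.distrib)
qed

lemma subst_single:
  "subst a b (Poly_Mapping.single (Word us) c) = scale c (prod_list (map (case_gen a b) us))"
  by (simp add: subst_eq_sum[of "{Word us}"])

lemma subst_scale: "subst a b (scale c p) = scale c (subst a b p)"
proof (induction p rule: single_word_induct)
  case zero
  then show ?case by (simp add: scale_conv_mult subst_def)
next
  case (add p q)
  then show ?case by (simp add: scale_add_right subst_add)
next
  case (single us d)
  have "scale c (Poly_Mapping.single (Word us) d) = Poly_Mapping.single (Word us) (c * d)"
    by (simp add: scale_conv_mult mult_single)
  then show ?case by (simp add: subst_single scale_scale)
qed

lemma subst_one: "subst a b 1 = 1"
  using subst_single[of a b "[]" 1] by (simp add: single_Word_Nil scale_conv_mult)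

lemma subst_X: "subst a b X = a" and subst_Y: "subst a b Y = b"
  by (simp_all add: X_def Y_def subst_single scale_conv_mult)

text \<open>
  Prepending a letter to a word multiplies its image on the left by the image of that letter. By
  linearity this gives multiplicativity for a left factor that is a generator, the only
  substantial case of \<open>subst_mult\<close>: the property of \<open>p\<close> that
  \<open>subst a b (p * q) = subst a b p * subst a b q\<close> for all \<open>q\<close> passes to sums, products and scalar
  multiples.
\<close>

lemma subst_generator_mult:
  "subst a b ((if g = GX then X else Y) * p) = case_gen a b g * subst a b p"
proof (induction p rule: single_word_induct)
  case zero
  show ?case by (simp add: subst_def)
next
  case (add p q)
  then show ?case by (simp add: distrib_left subst_add)
next
  case (single us c)
  show ?case
    by (simp only: subst_single scale_mult_right list.map prod_list.Cons flip: single_Word_Cons)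
qed

lemma subst_mult: "subst a b (p * q) = subst a b p * subst a b q"
proof (induction p arbitrary: q rule: free_alg_induct)
  case X
  show ?case using subst_generator_mult[of a b GX] by (simp add: subst_X)
next
  case Y
  show ?case using subst_generator_mult[of a b GY] by (simp add: subst_Y)
qed (simp_all add: subst_one distrib_right subst_add subst_scale scale_mult_left mult.assoc)

lemma alg_endomorphism_subst: "alg_endomorphism (subst a b)"
  by (simp add: alg_endomorphism_iff subst_add subst_scale subst_one subst_mult)

lemma alg_endomorphism_id: "alg_endomorphism id"
  by (simp add: alg_endomorphism_iff)

lemma alg_endomorphism_comp:
  "alg_endomorphism f \<Longrightarrow> alg_endomorphism g \<Longrightarrow> alg_endomorphism (f \<circ> g)"
  by (simp add: alg_endomorphism_iff)

lemma alg_endomorphism_power: "alg_endomorphism f \<Longrightarrow> f (p ^ n) = f p ^ n"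
  by (induction n) (simp_all add: alg_endomorphism_iff)

section \<open>Elementary automorphisms\<close>

text \<open>
  Both substitutions fix \<open>Y\<close>, hence \<open>Y ^ n\<close>, so the two shifts of \<open>X\<close> cancel. By uniqueness it is
  enough to observe this on the generators.
\<close>

lemma subst_elementary_comp:
  shows "subst (X + Y ^ n) Y \<circ> subst (X - Y ^ n) Y = (id :: 'k::field free_alg \<Rightarrow> _)"
    and "subst (X - Y ^ n) Y \<circ> subst (X + Y ^ n) Y = (id :: 'k free_alg \<Rightarrow> _)"
proof -
  have power: "subst c Y (Y ^ n) = Y ^ n" for c :: "'k free_alg"
    by (simp add: alg_endomorphism_power alg_endomorphism_subst subst_Y)
  have diff: "subst c Y (X - Y ^ n) = c - Y ^ n" for c :: "'k free_alg"
    using subst_add[of c Y "X - Y ^ n" "Y ^ n"] by (simp add: power subst_X eq_diff_eq)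
  have add: "subst c Y (X + Y ^ n) = c + Y ^ n" for c :: "'k free_alg"
    by (simp add: power subst_X subst_add)
  show "subst (X + Y ^ n) Y \<circ> subst (X - Y ^ n) Y = (id :: 'k free_alg \<Rightarrow> _)"
    by (intro alg_endomorphism_eqI alg_endomorphism_comp alg_endomorphism_subst
        alg_endomorphism_id) (simp_all add: subst_X subst_Y diff)
  show "subst (X - Y ^ n) Y \<circ> subst (X + Y ^ n) Y = (id :: 'k free_alg \<Rightarrow> _)"
    by (intro alg_endomorphism_eqI alg_endomorphism_comp alg_endomorphism_subst
        alg_endomorphism_id) (simp_all add: subst_X subst_Y add)
qed

lemma alg_automorphism_elementary: "alg_automorphism (subst (X + Y ^ n) (Y :: 'k::field free_alg))"
proof -
  have "bij (subst (X + Y ^ n) (Y :: 'k free_alg))"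
    by (rule o_bij) (fact subst_elementary_comp)+
  then show ?thesis
    using alg_endomorphism_subst by (simp add: alg_automorphism_def alg_endomorphism_def)
qed

lemma power_Y: "Y ^ n = (Poly_Mapping.single (Word (replicate n GY)) 1 :: 'k::field free_alg)"
  by (induction n) (simp_all add: single_Word_Nil single_Word_Cons scale_conv_mult)

lemma length_le_deg: "Poly_Mapping.lookup p (Word us) \<noteq> 0 \<Longrightarrow> length us \<le> deg p"
  unfolding deg_def by (rule Max_ge) (auto simp: in_keys_iff intro!: rev_image_eqI[of "Word us"])

lemma aut_deg_elementary:
  "n \<le> aut_deg (subst (X + Y ^ n) (Y :: 'k::field free_alg))"
proof -
  have "Poly_Mapping.lookup (X + Y ^ n :: 'k free_alg) (Word (replicate n GY)) \<noteq> 0"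
    by (auto simp: power_Y X_def lookup_add lookup_single when_def Cons_replicate_eq)
  from length_le_deg[OF this] show ?thesis
    by (simp add: aut_deg_def subst_X)
qed

section \<open>Iterated commutators with Y\<close>

lemma lookup_mult_Y:
  "Poly_Mapping.lookup (p * Y) (Word (us @ [GY])) = Poly_Mapping.lookup p (Word us)"
  for p :: "'k::field free_alg"
  by (induction p rule: single_word_induct)
    (simp_all add: Y_def mult_single plus_fmonoid_def lookup_single when_def lookup_add
      distrib_right)

lemma lookup_Y_mult:
  "Poly_Mapping.lookup (Y * p) (Word (GX # us)) = 0"
  for p :: "'k::field free_alg"
  by (induction p rule: single_word_induct)
    (simp_all add: Y_def mult_single plus_fmonoid_def lookup_single when_def lookup_add
      distrib_left)

text \<open>
  Tracking a single coefficient suffices to see that the iterates do not vanish, and the word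
  \<open>X Y\<^sup>n\<close> is a good choice because only one of the two summands of a commutator with \<open>Y\<close> can
  contribute to it.
\<close>

lemma lookup_iterated_commutator:
  "Poly_Mapping.lookup (((\<lambda>p. p * Y - Y * p) ^^ n) (X :: 'k::field free_alg))
     (Word (GX # replicate n GY)) = 1"
proof (induction n)
  case 0
  show ?case by (simp add: X_def)
next
  case (Suc n)
  let ?q = "((\<lambda>p. p * Y - Y * p) ^^ n) (X :: 'k free_alg)"
  have word: "GX # replicate (Suc n) GY = (GX # replicate n GY) @ [GY]"
    by (simp add: replicate_append_same)
  have "Poly_Mapping.lookup (?q * Y) (Word (GX # replicate (Suc n) GY)) = 1"
    using Suc.IH by (simp only: word lookup_mult_Y)
  moreover have "Poly_Mapping.lookup (Y * ?q) (Word (GX # replicate (Suc n) GY)) = 0"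
    by (rule lookup_Y_mult)
  ultimately show ?case by (simp add: lookup_minus)
qed

theorem proposition27:
  fixes D :: "'k::{alg_closed_field, field_char_0} free_alg \<Rightarrow> 'k free_alg"
  assumes "derivation D"
    and "D X = X * Y - Y * X"
    and "D Y = 0"
  shows "\<not> locally_nilpotent D \<and> (\<forall>d\<ge>1. \<exists>\<rho>\<in>Aut_comm D. aut_deg \<rho> \<ge> d)"
proof
  have D: "D = (\<lambda>p. p * Y - Y * p)"
    by (rule derivation_eqI) (use assms in \<open>simp_all add: derivation_commutator_Y\<close>)
  have "(D ^^ n) X \<noteq> 0" for n
    using lookup_iterated_commutator[of n, where ?'k = 'k] by (auto simp: D)
  then show "\<not> locally_nilpotent D"
    by (auto simp: locally_nilpotent_def)
  show "\<forall>d\<ge>1. \<exists>\<rho>\<in>Aut_comm D. aut_deg \<rho> \<ge> d"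
  proof (intro allI impI)
    fix d :: nat
    let ?\<rho> = "subst (X + Y ^ d) Y :: 'k free_alg \<Rightarrow> _"
    have "?\<rho> (p * Y - Y * p) = ?\<rho> p * Y - Y * ?\<rho> p" for p
      using subst_add[of "X + Y ^ d" Y "p * Y - Y * p" "Y * p"]
      by (simp add: subst_mult subst_Y algebra_simps)
    then have "?\<rho> \<in> Aut_comm D"
      by (simp add: Aut_comm_def alg_automorphism_elementary D fun_eq_iff)
    then show "\<exists>\<rho>\<in>Aut_comm D. aut_deg \<rho> \<ge> d"
      using aut_deg_elementary by blast
  qed
qed

end
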